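(* Let $R$ be a noetherian integral domain (commutative), let $\mathcal{P}\subseteq R$ be any set all of whose elements are prime elements of $R$, and let $S$ be the submonoid of the multiplicative monoid of $R$ generated by $\mathcal{P}$. If the localization $S^{-1}R$ is a unique factorization domain, then $R$ is a unique factorization domain.
   Context: $S^{-1}R$ denotes the ring of fractions $a/s$ with $a\in R$, $s\in S$. The submonoid generated by $\mathcal{P}$ is the smallest subset of $R$ containing $1$ and $\mathcal{P}$ and closed under multiplication. *)

theory Defs
  imports "HOL-Algebra.Ring_Divisibility"
begin

inductive_set submonoid_generate :: "('a, 'b) monoid_scheme \<Rightarrow> 'a set \<Rightarrow> 'a set"
  for G and H where
    one:  "\<one>\<^bsub>G\<^esub> \<in> submonoid_generate G H"
  | incl: "h \<in> H \<Longrightarrow> h \<in> submonoid_generate G H"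
  | mult: "h1 \<in> submonoid_generate G H \<Longrightarrow> h2 \<in> submonoid_generate G H
            \<Longrightarrow> h1 \<otimes>\<^bsub>G\<^esub> h2 \<in> submonoid_generate G H"

lemma (in monoid) submonoid_generate_is_submonoid:
  assumes "H \<subseteq> carrier G"
  shows "submonoid (submonoid_generate G H) G"
proof
  show "submonoid_generate G H \<subseteq> carrier G"
  proof
    fix x assume "x \<in> submonoid_generate G H"
    then show "x \<in> carrier G"
      by induction (use assms in auto)
  qed
qed (auto intro: submonoid_generate.intros)

lemma submonoid_generate_least:
  assumes "submonoid K G" "H \<subseteq> K"
  shows "submonoid_generate G H \<subseteq> K"
proof
  fix x assume "x \<in> submonoid_generate G H"
  then show "x \<in> K"
    by induction (use assms submonoid.one_closed submonoid.m_closed in \<open>auto\<close>)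
qed


text \<open>A pair \<open>(a, s)\<close> represents \<open>a/s\<close>. The factor \<open>u\<close> is what makes this an equivalence
  relation when \<open>S\<close> contains zero divisors; in a domain with \<open>\<zero> \<notin> S\<close> it can be dropped.\<close>

definition fraction_rel :: "('a, 'b) ring_scheme \<Rightarrow> 'a set \<Rightarrow> (('a \<times> 'a) \<times> ('a \<times> 'a)) set"
  where "fraction_rel R S =
    {((a, s), (b, t)). a \<in> carrier R \<and> s \<in> S \<and> b \<in> carrier R \<and> t \<in> S \<and>
       (\<exists>u\<in>S. u \<otimes>\<^bsub>R\<^esub> (t \<otimes>\<^bsub>R\<^esub> a \<ominus>\<^bsub>R\<^esub> s \<otimes>\<^bsub>R\<^esub> b) = \<zero>\<^bsub>R\<^esub>)}"

definition fraction :: "('a, 'b) ring_scheme \<Rightarrow> 'a set \<Rightarrow> 'a \<Rightarrow> 'a \<Rightarrow> ('a \<times> 'a) set"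
  where "fraction R S a s = fraction_rel R S `` {(a, s)}"

text \<open>In \<open>mult\<close> and \<open>add\<close> the union ranges over all representatives; all of them yield the same
  class, see \<open>localization_mult\<close> and \<open>localization_add\<close> below.\<close>

definition localization :: "('a, 'b) ring_scheme \<Rightarrow> 'a set \<Rightarrow> ('a \<times> 'a) set ring"
  where "localization R S =
    \<lparr> carrier = (carrier R \<times> S) // fraction_rel R S,
      mult = (\<lambda>X Y. \<Union>(a, s)\<in>X. \<Union>(b, t)\<in>Y. fraction R S (a \<otimes>\<^bsub>R\<^esub> b) (s \<otimes>\<^bsub>R\<^esub> t)),
      one = fraction R S \<one>\<^bsub>R\<^esub> \<one>\<^bsub>R\<^esub>,
      zero = fraction R S \<zero>\<^bsub>R\<^esub> \<one>\<^bsub>R\<^esub>,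
      add = (\<lambda>X Y. \<Union>(a, s)\<in>X. \<Union>(b, t)\<in>Y.
               fraction R S (t \<otimes>\<^bsub>R\<^esub> a \<oplus>\<^bsub>R\<^esub> s \<otimes>\<^bsub>R\<^esub> b) (s \<otimes>\<^bsub>R\<^esub> t)) \<rparr>"

locale cring_submonoid = cring R + submonoid S R for R (structure) and S
begin

lemma S_carr: "s \<in> S \<Longrightarrow> s \<in> carrier R"
  using subset by blast

lemma fraction_rel_iff:
  "((a, s), (b, t)) \<in> fraction_rel R S \<longleftrightarrow>
     a \<in> carrier R \<and> s \<in> S \<and> b \<in> carrier R \<and> t \<in> S \<and>
     (\<exists>u\<in>S. u \<otimes> (t \<otimes> a \<ominus> s \<otimes> b) = \<zero>)"
  by (simp add: fraction_rel_def)

lemma equiv_fraction_rel: "equiv (carrier R \<times> S) (fraction_rel R S)"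
proof (rule equivI)
  show "fraction_rel R S \<subseteq> (carrier R \<times> S) \<times> (carrier R \<times> S)"
    by (auto simp: fraction_rel_def)
  show "refl_on (carrier R \<times> S) (fraction_rel R S)"
  proof (rule refl_onI)
    fix x assume "x \<in> carrier R \<times> S"
    then obtain a s where x: "x = (a, s)" "a \<in> carrier R" "s \<in> S" by auto
    then have "\<one> \<otimes> (s \<otimes> a \<ominus> s \<otimes> a) = \<zero>"
      using S_carr[of s] by (simp add: minus_eq r_neg)
    then show "(x, x) \<in> fraction_rel R S"
      unfolding x(1) fraction_rel_iff using x(2,3) one_closed by blast
  qed
  show "sym (fraction_rel R S)"
  proof (rule symI)
    fix x y assume xy: "(x, y) \<in> fraction_rel R S"
    obtain a s b t where [simp]: "x = (a, s)" "y = (b, t)" by (cases x, cases y)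
    from xy obtain u where c: "a \<in> carrier R" "s \<in> S" "b \<in> carrier R" "t \<in> S" "u \<in> S"
      and u: "u \<otimes> (t \<otimes> a \<ominus> s \<otimes> b) = \<zero>" by (auto simp: fraction_rel_iff)
    have "u \<otimes> (s \<otimes> b \<ominus> t \<otimes> a) = \<ominus> (u \<otimes> (t \<otimes> a \<ominus> s \<otimes> b))"
      using c(1,3) S_carr[OF c(2)] S_carr[OF c(4)] S_carr[OF c(5)] by algebra
    then show "(y, x) \<in> fraction_rel R S"
      using c u by (auto simp: fraction_rel_iff)
  qed
  show "trans (fraction_rel R S)"
  proof (rule transI)
    fix x y z assume xy: "(x, y) \<in> fraction_rel R S" and yz: "(y, z) \<in> fraction_rel R S"
    obtain a s b t d r where [simp]: "x = (a, s)" "y = (b, t)" "z = (d, r)"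
      by (cases x, cases y, cases z)
    from xy obtain u where c: "a \<in> carrier R" "s \<in> S" "b \<in> carrier R" "t \<in> S" "u \<in> S"
      and u: "u \<otimes> (t \<otimes> a \<ominus> s \<otimes> b) = \<zero>" by (auto simp: fraction_rel_iff)
    from yz obtain v where d: "d \<in> carrier R" "r \<in> S" "v \<in> S"
      and v: "v \<otimes> (r \<otimes> b \<ominus> t \<otimes> d) = \<zero>" by (auto simp: fraction_rel_iff)
    note carr = c(1,3) d(1) S_carr[OF c(2)] S_carr[OF c(4)] S_carr[OF c(5)]
      S_carr[OF d(2)] S_carr[OF d(3)]
    have "(u \<otimes> v \<otimes> t) \<otimes> (r \<otimes> a \<ominus> s \<otimes> d) =
      (v \<otimes> r) \<otimes> (u \<otimes> (t \<otimes> a \<ominus> s \<otimes> b)) \<oplus> (u \<otimes> s) \<otimes> (v \<otimes> (r \<otimes> b \<ominus> t \<otimes> d))"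
      using carr by algebra
    also have "\<dots> = \<zero>" using carr by (simp add: u v)
    finally have "\<exists>w\<in>S. w \<otimes> (r \<otimes> a \<ominus> s \<otimes> d) = \<zero>"
      using c d by (intro bexI[of _ "u \<otimes> v \<otimes> t"]) auto
    then show "(x, z) \<in> fraction_rel R S"
      using c d by (auto simp: fraction_rel_iff)
  qed
qed

lemma fraction_eq_iff:
  assumes "a \<in> carrier R" "s \<in> S" "b \<in> carrier R" "t \<in> S"
  shows "fraction R S a s = fraction R S b t \<longleftrightarrow> (\<exists>u\<in>S. u \<otimes> (t \<otimes> a \<ominus> s \<otimes> b) = \<zero>)"
  using assms eq_equiv_class_iff[OF equiv_fraction_rel, of "(a, s)" "(b, t)"]
  by (auto simp: fraction_def fraction_rel_iff)

lemma mult_minus_zero_iff: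
  assumes "u \<in> carrier R" "x \<in> carrier R" "y \<in> carrier R"
  shows "u \<otimes> (x \<ominus> y) = \<zero> \<longleftrightarrow> u \<otimes> x = u \<otimes> y"
proof -
  have "u \<otimes> (x \<ominus> y) = u \<otimes> x \<ominus> u \<otimes> y"
    using assms by algebra
  then show ?thesis
    using assms by (simp add: r_right_minus_eq)
qed

lemma fraction_eqI:
  assumes "a \<in> carrier R" "s \<in> S" "b \<in> carrier R" "t \<in> S"
    and "u \<in> S" "u \<otimes> (t \<otimes> a) = u \<otimes> (s \<otimes> b)"
  shows "fraction R S a s = fraction R S b t"
proof -
  have "u \<otimes> (t \<otimes> a \<ominus> s \<otimes> b) = \<zero>"
    using assms S_carr by (simp add: mult_minus_zero_iff)
  then show ?thesis
    using assms by (subst fraction_eq_iff) blast+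
qed

lemma mem_fraction_iff:
  "(b, t) \<in> fraction R S a s \<longleftrightarrow> ((a, s), (b, t)) \<in> fraction_rel R S"
  by (simp add: fraction_def)

lemma fraction_self:
  assumes "a \<in> carrier R" "s \<in> S"
  shows "(a, s) \<in> fraction R S a s"
  using assms equiv_fraction_rel by (auto simp: mem_fraction_iff equiv_def refl_on_def)

lemma carrier_localization:
  "carrier (localization R S) = {fraction R S a s | a s. a \<in> carrier R \<and> s \<in> S}"
  by (auto simp: localization_def quotient_def fraction_def)

lemma fraction_closed:
  assumes "a \<in> carrier R" "s \<in> S"
  shows "fraction R S a s \<in> carrier (localization R S)"
  using assms unfolding carrier_localization by blast

lemma in_localizationE:
  assumes "x \<in> carrier (localization R S)"
  obtains a s where "x = fraction R S a s" "a \<in> carrier R" "s \<in> S"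
  using assms by (auto simp: carrier_localization)

lemma one_localization: "\<one>\<^bsub>localization R S\<^esub> = fraction R S \<one> \<one>"
  and zero_localization: "\<zero>\<^bsub>localization R S\<^esub> = fraction R S \<zero> \<one>"
  by (simp_all add: localization_def)

lemma mem_fractionE:
  assumes "(b, t) \<in> fraction R S a s"
  obtains u where "a \<in> carrier R" "s \<in> S" "b \<in> carrier R" "t \<in> S" "u \<in> S"
    "u \<otimes> (t \<otimes> a) = u \<otimes> (s \<otimes> b)"
proof -
  from assms obtain u where c: "a \<in> carrier R" "s \<in> S" "b \<in> carrier R" "t \<in> S" "u \<in> S"
    and "u \<otimes> (t \<otimes> a \<ominus> s \<otimes> b) = \<zero>" by (auto simp: mem_fraction_iff fraction_rel_iff)
  then have "u \<otimes> (t \<otimes> a) = u \<otimes> (s \<otimes> b)"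
    using S_carr by (simp add: mult_minus_zero_iff)
  with c show thesis by (rule that)
qed

lemma UN_fractions:
  assumes "a \<in> carrier R" "s \<in> S" "b \<in> carrier R" "t \<in> S"
    and "\<And>a' s' b' t'. (a', s') \<in> fraction R S a s \<Longrightarrow> (b', t') \<in> fraction R S b t
           \<Longrightarrow> f a' s' b' t' = f a s b t"
  shows "(\<Union>(a', s')\<in>fraction R S a s. \<Union>(b', t')\<in>fraction R S b t. f a' s' b' t') = f a s b t"
proof -
  have "(\<Union>(b', t')\<in>fraction R S b t. f a' s' b' t') = f a s b t"
    if "(a', s') \<in> fraction R S a s" for a' s'
  proof (rule SUP_eq_const)
    show "fraction R S b t \<noteq> {}" using fraction_self[OF assms(3,4)] by blast
  qed (use assms(5)[OF that] in \<open>auto\<close>)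
  note inner = this
  show ?thesis
  proof (rule SUP_eq_const)
    show "fraction R S a s \<noteq> {}" using fraction_self[OF assms(1,2)] by blast
  qed (use inner in \<open>auto\<close>)
qed

lemma localization_mult:
  assumes "a \<in> carrier R" "s \<in> S" "b \<in> carrier R" "t \<in> S"
  shows "fraction R S a s \<otimes>\<^bsub>localization R S\<^esub> fraction R S b t = fraction R S (a \<otimes> b) (s \<otimes> t)"
proof -
  have "fraction R S (a' \<otimes> b') (s' \<otimes> t') = fraction R S (a \<otimes> b) (s \<otimes> t)"
    if 1: "(a', s') \<in> fraction R S a s" and 2: "(b', t') \<in> fraction R S b t" for a' s' b' t'
  proof -
    from 1 obtain u where c: "a' \<in> carrier R" "s' \<in> S" "u \<in> S"
      and u: "u \<otimes> (s' \<otimes> a) = u \<otimes> (s \<otimes> a')" by (auto elim: mem_fractionE)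
    from 2 obtain v where d: "b' \<in> carrier R" "t' \<in> S" "v \<in> S"
      and v: "v \<otimes> (t' \<otimes> b) = v \<otimes> (t \<otimes> b')" by (auto elim: mem_fractionE)
    note carr = assms(1,3) c(1) d(1) assms(2,4)[THEN S_carr] c(2,3)[THEN S_carr] d(2,3)[THEN S_carr]
    have "(u \<otimes> v) \<otimes> ((s \<otimes> t) \<otimes> (a' \<otimes> b')) = (u \<otimes> (s \<otimes> a')) \<otimes> (v \<otimes> (t \<otimes> b'))"
      using carr by (simp add: m_ac)
    also have "\<dots> = (u \<otimes> (s' \<otimes> a)) \<otimes> (v \<otimes> (t' \<otimes> b))"
      by (simp only: u v)
    also have "\<dots> = (u \<otimes> v) \<otimes> ((s' \<otimes> t') \<otimes> (a \<otimes> b))"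
      using carr by (simp add: m_ac)
    finally show ?thesis
      using assms c d by (intro fraction_eqI[where u = "u \<otimes> v"]) auto
  qed
  then show ?thesis
    using UN_fractions[OF assms, of "\<lambda>a s b t. fraction R S (a \<otimes> b) (s \<otimes> t)"]
    by (simp add: localization_def)
qed

lemma localization_add:
  assumes "a \<in> carrier R" "s \<in> S" "b \<in> carrier R" "t \<in> S"
  shows "fraction R S a s \<oplus>\<^bsub>localization R S\<^esub> fraction R S b t
           = fraction R S (t \<otimes> a \<oplus> s \<otimes> b) (s \<otimes> t)"
proof -
  have "fraction R S (t' \<otimes> a' \<oplus> s' \<otimes> b') (s' \<otimes> t') = fraction R S (t \<otimes> a \<oplus> s \<otimes> b) (s \<otimes> t)"
    if 1: "(a', s') \<in> fraction R S a s" and 2: "(b', t') \<in> fraction R S b t" for a' s' b' t'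
  proof -
    from 1 obtain u where c: "a' \<in> carrier R" "s' \<in> S" "u \<in> S"
      and u: "u \<otimes> (s' \<otimes> a) = u \<otimes> (s \<otimes> a')" by (auto elim: mem_fractionE)
    from 2 obtain v where d: "b' \<in> carrier R" "t' \<in> S" "v \<in> S"
      and v: "v \<otimes> (t' \<otimes> b) = v \<otimes> (t \<otimes> b')" by (auto elim: mem_fractionE)
    note carr = assms(1,3) c(1) d(1) assms(2,4)[THEN S_carr] c(2,3)[THEN S_carr] d(2,3)[THEN S_carr]
    have "(u \<otimes> v) \<otimes> ((s \<otimes> t) \<otimes> (t' \<otimes> a' \<oplus> s' \<otimes> b'))
        = (v \<otimes> t \<otimes> t') \<otimes> (u \<otimes> (s \<otimes> a')) \<oplus> (u \<otimes> s \<otimes> s') \<otimes> (v \<otimes> (t \<otimes> b'))"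
      using carr by (simp add: r_distr m_ac)
    also have "\<dots> = (v \<otimes> t \<otimes> t') \<otimes> (u \<otimes> (s' \<otimes> a)) \<oplus> (u \<otimes> s \<otimes> s') \<otimes> (v \<otimes> (t' \<otimes> b))"
      by (simp only: u v)
    also have "\<dots> = (u \<otimes> v) \<otimes> ((s' \<otimes> t') \<otimes> (t \<otimes> a \<oplus> s \<otimes> b))"
      using carr by (simp add: r_distr m_ac)
    finally show ?thesis
      using assms c d carr by (intro fraction_eqI[where u = "u \<otimes> v"]) auto
  qed
  then show ?thesis
    using UN_fractions[OF assms, of "\<lambda>a s b t. fraction R S (t \<otimes> a \<oplus> s \<otimes> b) (s \<otimes> t)"]
    by (simp add: localization_def)
qed

lemma fraction_cancel:
  assumes "a \<in> carrier R" "s \<in> S" "r \<in> S"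
  shows "fraction R S (r \<otimes> a) (r \<otimes> s) = fraction R S a s"
  using assms S_carr by (intro fraction_eqI[where u = \<one>]) (auto simp: m_ac)

lemma fraction_zero:
  assumes "s \<in> S"
  shows "fraction R S \<zero> s = fraction R S \<zero> \<one>"
  using assms S_carr by (intro fraction_eqI[where u = \<one>]) auto

lemma cring_localization: "cring (localization R S)"
proof (rule cringI)
  let ?L = "localization R S"
  show "abelian_group ?L"
  proof (rule abelian_groupI)
    fix x y z assume "x \<in> carrier ?L" "y \<in> carrier ?L" "z \<in> carrier ?L"
    then obtain a s b t d r where [simp]: "x = fraction R S a s" "y = fraction R S b t"
      "z = fraction R S d r" and c: "a \<in> carrier R" "b \<in> carrier R" "d \<in> carrier R"
      "s \<in> S" "t \<in> S" "r \<in> S" by (elim in_localizationE)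
    note carr = c(1-3) c(4-6)[THEN S_carr]
    show "x \<oplus>\<^bsub>?L\<^esub> y \<in> carrier ?L"
      using c carr by (simp add: localization_add fraction_closed)
    have e1: "(r \<otimes> (t \<otimes> a \<oplus> s \<otimes> b) \<oplus> (s \<otimes> t) \<otimes> d)
        = ((t \<otimes> r) \<otimes> a \<oplus> s \<otimes> (r \<otimes> b \<oplus> t \<otimes> d))"
      using carr by algebra
    have e2: "(s \<otimes> t) \<otimes> r = s \<otimes> (t \<otimes> r)"
      using carr by algebra
    show "x \<oplus>\<^bsub>?L\<^esub> y \<oplus>\<^bsub>?L\<^esub> z = x \<oplus>\<^bsub>?L\<^esub> (y \<oplus>\<^bsub>?L\<^esub> z)"
      using c carr by (simp add: localization_add e1 e2)
    have e3: "t \<otimes> a \<oplus> s \<otimes> b = s \<otimes> b \<oplus> t \<otimes> a" "s \<otimes> t = t \<otimes> s"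
      using carr by algebra+
    show "x \<oplus>\<^bsub>?L\<^esub> y = y \<oplus>\<^bsub>?L\<^esub> x"
      using c carr by (simp add: localization_add e3)
  next
    show "\<zero>\<^bsub>?L\<^esub> \<in> carrier ?L"
      using one_closed by (simp add: zero_localization fraction_closed)
  next
    fix x assume "x \<in> carrier ?L"
    then obtain a s where [simp]: "x = fraction R S a s" and c: "a \<in> carrier R" "s \<in> S"
      by (elim in_localizationE)
    note carr = c(1) S_carr[OF c(2)]
    show "\<zero>\<^bsub>?L\<^esub> \<oplus>\<^bsub>?L\<^esub> x = x"
      using c carr one_closed by (simp add: zero_localization localization_add)
    have "s \<otimes> (\<ominus> a) \<oplus> s \<otimes> a = \<zero>" using carr by algebra
    then have "fraction R S (\<ominus> a) s \<oplus>\<^bsub>?L\<^esub> x = \<zero>\<^bsub>?L\<^esub>"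
      using c carr fraction_zero[of "s \<otimes> s"] by (simp add: localization_add zero_localization)
    then show "\<exists>y\<in>carrier ?L. y \<oplus>\<^bsub>?L\<^esub> x = \<zero>\<^bsub>?L\<^esub>"
      using c a_inv_closed fraction_closed by blast
  qed
  show "comm_monoid ?L"
  proof (rule comm_monoidI)
    fix x y z assume "x \<in> carrier ?L" "y \<in> carrier ?L" "z \<in> carrier ?L"
    then obtain a s b t d r where [simp]: "x = fraction R S a s" "y = fraction R S b t"
      "z = fraction R S d r" and c: "a \<in> carrier R" "b \<in> carrier R" "d \<in> carrier R"
      "s \<in> S" "t \<in> S" "r \<in> S" by (elim in_localizationE)
    note carr = c(1-3) c(4-6)[THEN S_carr]
    show "x \<otimes>\<^bsub>?L\<^esub> y \<in> carrier ?L"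
      using c carr by (simp add: localization_mult fraction_closed)
    show "x \<otimes>\<^bsub>?L\<^esub> y \<otimes>\<^bsub>?L\<^esub> z = x \<otimes>\<^bsub>?L\<^esub> (y \<otimes>\<^bsub>?L\<^esub> z)"
      using c carr by (simp add: localization_mult m_assoc)
    have e: "a \<otimes> b = b \<otimes> a" "s \<otimes> t = t \<otimes> s"
      using carr by algebra+
    show "x \<otimes>\<^bsub>?L\<^esub> y = y \<otimes>\<^bsub>?L\<^esub> x"
      using c carr by (simp add: localization_mult e)
  next
    show "\<one>\<^bsub>?L\<^esub> \<in> carrier ?L"
      using one_closed by (simp add: one_localization fraction_closed)
  next
    fix x assume "x \<in> carrier ?L"
    then obtain a s where [simp]: "x = fraction R S a s" and c: "a \<in> carrier R" "s \<in> S"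
      by (elim in_localizationE)
    show "\<one>\<^bsub>?L\<^esub> \<otimes>\<^bsub>?L\<^esub> x = x"
      using c S_carr[OF c(2)] one_closed by (simp add: one_localization localization_mult)
  qed
  fix x y z assume "x \<in> carrier ?L" "y \<in> carrier ?L" "z \<in> carrier ?L"
  then obtain a s b t d r where [simp]: "x = fraction R S a s" "y = fraction R S b t"
    "z = fraction R S d r" and c: "a \<in> carrier R" "b \<in> carrier R" "d \<in> carrier R"
    "s \<in> S" "t \<in> S" "r \<in> S" by (elim in_localizationE)
  note carr = c(1-3) c(4-6)[THEN S_carr]
  have "(t \<otimes> r) \<otimes> (a \<otimes> d) \<oplus> (s \<otimes> r) \<otimes> (b \<otimes> d) = r \<otimes> ((t \<otimes> a \<oplus> s \<otimes> b) \<otimes> d)"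
    and "(s \<otimes> r) \<otimes> (t \<otimes> r) = r \<otimes> ((s \<otimes> t) \<otimes> r)"
    using carr by (simp_all add: l_distr r_distr m_ac)
  then have "fraction R S ((t \<otimes> a \<oplus> s \<otimes> b) \<otimes> d) ((s \<otimes> t) \<otimes> r) =
    fraction R S ((t \<otimes> r) \<otimes> (a \<otimes> d) \<oplus> (s \<otimes> r) \<otimes> (b \<otimes> d)) ((s \<otimes> r) \<otimes> (t \<otimes> r))"
    using c carr by (simp add: fraction_cancel)
  then show "(x \<oplus>\<^bsub>?L\<^esub> y) \<otimes>\<^bsub>?L\<^esub> z = x \<otimes>\<^bsub>?L\<^esub> z \<oplus>\<^bsub>?L\<^esub> y \<otimes>\<^bsub>?L\<^esub> z"
    using c carr by (simp add: localization_add localization_mult)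
qed

end

end

theory Submission
  imports Defs
begin

text \<open>The statement is Nagata's criterion. In a noetherian domain every nonzero nonunit is a product
  of irreducibles, so \<open>R\<close> is factorial as soon as every irreducible \<open>a\<close> is prime. If some
  \<open>p \<in> P\<close> divides \<open>a\<close>, then \<open>a\<close> is associated to the prime \<open>p\<close>. Otherwise \<open>a\<close> shares no
  nonunit factor with any element of \<open>S\<close>, and primality can be pulled back from the localization:

  \<^item> Factors from \<open>S\<close> can be cancelled: if \<open>a\<close> divides \<open>s y\<close> with \<open>s \<in> S\<close>, then \<open>a\<close> divides \<open>y\<close>
    (\<open>divides_generated_cancel\<close>). Hence divisibility by \<open>a/1\<close> in the localization is the same as
    divisibility by \<open>a\<close> in \<open>R\<close>.
  \<^item> An equation \<open>a/1 = (x/s) (y/t)\<close> reads \<open>(s t) a = x y\<close>. As \<open>s t\<close> is a product of primes, its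
    factors can be distributed over \<open>x\<close> and \<open>y\<close> (\<open>generated_mult_split\<close>), which leaves a
    factorization of \<open>a\<close> in \<open>R\<close>; one of its two factors is a unit there. Hence \<open>a/1\<close> is
    irreducible.

  The localization is factorial, so \<open>a/1\<close> is prime in it, and by the first point \<open>a\<close> is prime
  in \<open>R\<close>.\<close>


section \<open>Submonoids generated by prime elements\<close>

locale domain_with_primes = domain R for R (structure) +
  fixes P :: "'a set"
  assumes primes_carrier: "P \<subseteq> carrier R"
    and primes: "p \<in> P \<Longrightarrow> ring_prime p"
begin

abbreviation S :: "'a set"
  where "S \<equiv> submonoid_generate R P"

abbreviation L :: "('a \<times> 'a) set ring"
  where "L \<equiv> localization R S"

sublocale cring_submonoid R S
  by (intro cring_submonoid.intro is_cring submonoid_generate_is_submonoid primes_carrier)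

lemma prime_in_carrier: "p \<in> P \<Longrightarrow> p \<in> carrier R"
  using primes_carrier by blast

lemma prime_nonzero: "p \<in> P \<Longrightarrow> p \<noteq> \<zero>"
  using primes by (simp add: ring_prime_def)

lemma prime_divides_mult:
  assumes "p \<in> P" "a \<in> carrier R" "b \<in> carrier R" "p divides a \<otimes> b"
  shows "p divides a \<or> p divides b"
  using primes[OF assms(1)] assms(2-) by (auto simp: ring_prime_def prime_def)

lemma generated_nonzero:
  assumes "s \<in> S"
  shows "s \<noteq> \<zero>"
  using assms by induction (auto simp: prime_nonzero integral_iff S_carr)

text \<open>A prime \<open>p \<in> P\<close> dividing \<open>a c = p y\<close> must divide \<open>c\<close>, so it cancels; a product of
  elements of \<open>P\<close> cancels one factor at a time.\<close>

lemma divides_generated_cancel: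
  assumes "s \<in> S" "a \<in> carrier R" "\<And>p. p \<in> P \<Longrightarrow> \<not> p divides a"
    and "y \<in> carrier R" "a divides s \<otimes> y"
  shows "a divides y"
  using assms(1,4,5)
proof (induction arbitrary: y)
  case one
  then show ?case by simp
next
  case (incl p)
  from incl.prems(2) obtain c where c: "c \<in> carrier R" "p \<otimes> y = a \<otimes> c"
    by (rule dividesE)
  have "p divides a \<otimes> c"
    using incl.prems(1) c(2)[symmetric] by (rule dividesI)
  then have "p divides c"
    using prime_divides_mult[OF incl.hyps assms(2) c(1)] assms(3)[OF incl.hyps] by simp
  then obtain d where d: "d \<in> carrier R" "c = p \<otimes> d" by (rule dividesE)
  have "p \<otimes> y = p \<otimes> (a \<otimes> d)"
    using c(2) d assms(2) prime_in_carrier[OF incl.hyps] by (simp add: m_lcomm)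
  then have "y = a \<otimes> d"
    using m_lcancel prime_nonzero[OF incl.hyps] prime_in_carrier[OF incl.hyps] incl.prems d(1)
      assms(2) by simp
  then show ?case using d(1) by blast
next
  case (mult h1 h2)
  have "a divides h1 \<otimes> (h2 \<otimes> y)"
    using mult.prems mult.hyps[THEN S_carr] by (simp add: m_assoc)
  then have "a divides h2 \<otimes> y"
    using mult.IH(1) mult.prems(1) mult.hyps[THEN S_carr] by simp
  then show ?case
    using mult.IH(2) mult.prems(1) by simp
qed

text \<open>For a single prime this is the definition of primality. A product \<open>h1 h2\<close> is handled by
  removing the factors of \<open>h1\<close> from \<open>x\<close> and \<open>y\<close> and then those of \<open>h2\<close> from what remains.\<close>

lemma generated_mult_split:
  assumes "s \<in> S" "a \<in> carrier R" "x \<in> carrier R" "y \<in> carrier R" "s \<otimes> a = x \<otimes> y"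
  shows "\<exists>s1\<in>S. \<exists>s2\<in>S. \<exists>x'\<in>carrier R. \<exists>y'\<in>carrier R.
           x = s1 \<otimes> x' \<and> y = s2 \<otimes> y' \<and> a = x' \<otimes> y'"
  using assms
proof (induction arbitrary: a x y)
  case one
  then have "x = \<one> \<otimes> x" "y = \<one> \<otimes> y" "a = x \<otimes> y" by auto
  with one_closed one.prems(2,3) show ?case by blast
next
  case (incl p)
  note p = prime_in_carrier[OF incl.hyps] prime_nonzero[OF incl.hyps]
    submonoid_generate.incl[OF incl.hyps, of R]
  have "p divides x \<otimes> y"
    using incl.prems(1) incl.prems(4)[symmetric] by (rule dividesI)
  then consider "p divides x" | "p divides y"
    using prime_divides_mult[OF incl.hyps incl.prems(2,3)] by blast
  then show ?case
  proof cases
    case 1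
    then obtain d where d: "d \<in> carrier R" "x = p \<otimes> d" by (rule dividesE)
    then have "p \<otimes> a = p \<otimes> (d \<otimes> y)"
      using incl.prems p by (simp add: m_assoc)
    then have "a = d \<otimes> y"
      using m_lcancel p incl.prems d by simp
    moreover have "y = \<one> \<otimes> y" using incl.prems by simp
    ultimately show ?thesis
      using d p(3) one_closed incl.prems(3) by blast
  next
    case 2
    then obtain d where d: "d \<in> carrier R" "y = p \<otimes> d" by (rule dividesE)
    then have "p \<otimes> a = p \<otimes> (x \<otimes> d)"
      using incl.prems p by (simp add: m_lcomm)
    then have "a = x \<otimes> d"
      using m_lcancel p incl.prems d by simp
    moreover have "x = \<one> \<otimes> x" using incl.prems by simp
    ultimately show ?thesis
      using d p(3) one_closed incl.prems(2) by blast
  qed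
next
  case (mult h1 h2)
  note h = mult.hyps[THEN S_carr]
  have "h1 \<otimes> (h2 \<otimes> a) = x \<otimes> y"
    using mult.prems h by (simp add: m_assoc)
  then obtain s1 s2 x' y' where 1: "s1 \<in> S" "s2 \<in> S" "x' \<in> carrier R" "y' \<in> carrier R"
    "x = s1 \<otimes> x'" "y = s2 \<otimes> y'" "h2 \<otimes> a = x' \<otimes> y'"
    using mult.IH(1)[of "h2 \<otimes> a" x y] mult.prems(1-3) h by blast
  then obtain t1 t2 x'' y'' where 2: "t1 \<in> S" "t2 \<in> S" "x'' \<in> carrier R" "y'' \<in> carrier R"
    "x' = t1 \<otimes> x''" "y' = t2 \<otimes> y''" "a = x'' \<otimes> y''"
    using mult.IH(2)[of a x' y'] mult.prems(1) by blast
  have "x = (s1 \<otimes> t1) \<otimes> x''" "y = (s2 \<otimes> t2) \<otimes> y''"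
    using 1 2 S_carr by (simp_all add: m_assoc)
  moreover have "s1 \<otimes> t1 \<in> S" "s2 \<otimes> t2 \<in> S"
    using 1(1,2) 2(1,2) by (auto intro: submonoid_generate.mult)
  ultimately show ?case
    using 2(3,4,7) by blast
qed


section \<open>Comparing the domain with its localization\<close>

lemma fraction_eq_iff_domain:
  assumes "a \<in> carrier R" "s \<in> S" "b \<in> carrier R" "t \<in> S"
  shows "fraction R S a s = fraction R S b t \<longleftrightarrow> t \<otimes> a = s \<otimes> b"
proof
  assume "fraction R S a s = fraction R S b t"
  then obtain u where "u \<in> S" "u \<otimes> (t \<otimes> a \<ominus> s \<otimes> b) = \<zero>"
    using assms by (auto simp: fraction_eq_iff)
  then show "t \<otimes> a = s \<otimes> b"
    using assms S_carr generated_nonzero by (auto simp: integral_iff)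
next
  assume "t \<otimes> a = s \<otimes> b"
  then show "fraction R S a s = fraction R S b t"
    using assms by (intro fraction_eqI[where u = \<one>]) auto
qed

text \<open>An equation \<open>x/1 = (a/1) (c/s)\<close> only says that \<open>a\<close> divides \<open>s x\<close>; the condition on \<open>P\<close>
  allows the denominator to be cancelled.\<close>

lemma fraction_divides_imp_divides:
  assumes a: "a \<in> carrier R" "\<And>p. p \<in> P \<Longrightarrow> \<not> p divides a" and x: "x \<in> carrier R"
    and "fraction R S a \<one> divides\<^bsub>L\<^esub> fraction R S x \<one>"
  shows "a divides x"
proof -
  from assms(4) obtain z where z: "z \<in> carrier L"
    "fraction R S x \<one> = fraction R S a \<one> \<otimes>\<^bsub>L\<^esub> z" by (rule dividesE)
  from z(1) obtain c s where c: "z = fraction R S c s" "c \<in> carrier R" "s \<in> S"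
    by (rule in_localizationE)
  have "fraction R S x \<one> = fraction R S (a \<otimes> c) s"
    using z(2) a(1) c S_carr by (simp add: localization_mult)
  then have "s \<otimes> x = a \<otimes> c"
    using a(1) x c S_carr by (simp add: fraction_eq_iff_domain)
  then have "a divides s \<otimes> x"
    using c(2) by (rule dividesI')
  then show ?thesis
    using divides_generated_cancel c(3) a x by blast
qed

lemma fraction_in_Units:
  assumes "u \<in> Units R" "r \<in> S" "s \<in> S"
  shows "fraction R S (r \<otimes> u) s \<in> Units L"
proof -
  interpret L: cring L by (rule cring_localization)
  note c = Units_closed[OF assms(1)] Units_inv_closed[OF assms(1)] assms(2,3)[THEN S_carr]
  have "(r \<otimes> u) \<otimes> (inv u \<otimes> s) = r \<otimes> (u \<otimes> inv u) \<otimes> s"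
    using c by (simp add: m_assoc del: Units_r_inv)
  also have "\<dots> = s \<otimes> r"
    using c assms(1) by (simp add: m_comm)
  finally have "fraction R S \<one> \<one> = fraction R S ((r \<otimes> u) \<otimes> (inv u \<otimes> s)) (s \<otimes> r)"
    using c assms by (subst fraction_eq_iff_domain) auto
  also have "\<dots> = fraction R S (r \<otimes> u) s \<otimes>\<^bsub>L\<^esub> fraction R S (inv u \<otimes> s) r"
    using c assms by (simp add: localization_mult)
  finally have "fraction R S (r \<otimes> u) s divides\<^bsub>L\<^esub> \<one>\<^bsub>L\<^esub>"
    unfolding one_localization by (rule dividesI') (use c assms in \<open>simp add: fraction_closed\<close>)
  then show ?thesis
    using c assms by (simp add: L.divides_one fraction_closed)
qed

text \<open>Clearing denominators turns a factorization of \<open>a/1\<close> into \<open>(s t) a = x y\<close>; after the split, a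
  unit factor \<open>x'\<close> of \<open>a\<close> makes \<open>x/s = (s1 x')/s\<close> a unit. And if \<open>a/1\<close> were a unit, it
  would divide \<open>1/1\<close>, and then \<open>a\<close> would divide \<open>1\<close>.\<close>

lemma fraction_irreducible:
  assumes "domain L" and a: "a \<in> carrier R" "ring_irreducible a"
    and coprime: "\<And>p. p \<in> P \<Longrightarrow> \<not> p divides a"
  shows "ring_irreducible\<^bsub>L\<^esub> (fraction R S a \<one>)"
proof -
  interpret L: domain L by (rule assms(1))
  note irr = ring_irreducibleE[OF a]
  have closed: "fraction R S a \<one> \<in> carrier L"
    using a by (simp add: fraction_closed)
  show ?thesis
  proof (rule L.ring_irreducibleI)
    show "fraction R S a \<one> \<in> carrier L - {\<zero>\<^bsub>L\<^esub>}"
      using closed a irr(1) by (simp add: zero_localization fraction_eq_iff_domain)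
    show "fraction R S a \<one> \<notin> Units L"
    proof
      assume "fraction R S a \<one> \<in> Units L"
      then have "fraction R S a \<one> divides\<^bsub>L\<^esub> fraction R S \<one> \<one>"
        using closed by (simp add: L.divides_one[symmetric] one_localization)
      then have "a divides \<one>"
        using fraction_divides_imp_divides a(1) coprime by blast
      then show False
        using irr(4) a(1) by (simp add: divides_one)
    qed
    fix X Y assume X: "X \<in> carrier L" and Y: "Y \<in> carrier L"
      and XY: "fraction R S a \<one> = X \<otimes>\<^bsub>L\<^esub> Y"
    from X obtain x s where x: "X = fraction R S x s" "x \<in> carrier R" "s \<in> S"
      by (rule in_localizationE)
    from Y obtain y t where y: "Y = fraction R S y t" "y \<in> carrier R" "t \<in> S"
      by (rule in_localizationE)
    have "(s \<otimes> t) \<otimes> a = x \<otimes> y"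
      using XY a(1) x y S_carr by (simp add: localization_mult fraction_eq_iff_domain)
    then obtain s1 s2 x' y' where split: "s1 \<in> S" "s2 \<in> S" "x' \<in> carrier R" "y' \<in> carrier R"
      "x = s1 \<otimes> x'" "y = s2 \<otimes> y'" "a = x' \<otimes> y'"
      using generated_mult_split[of "s \<otimes> t" a x y] a(1) x y by auto
    then have "x' \<in> Units R \<or> y' \<in> Units R"
      using irr(5) by blast
    then show "X \<in> Units L \<or> Y \<in> Units L"
      using fraction_in_Units split x y by blast
  qed
qed


section \<open>Irreducible elements are prime\<close>

lemma irreducible_divisible_imp_prime:
  assumes a: "a \<in> carrier R" "ring_irreducible a" and p: "p \<in> P" "p divides a"
  shows "ring_prime a"
proof -
  note pc = prime_in_carrier[OF p(1)]
  have p_prime: "prime (mult_of R) p" "p \<notin> Units R"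
    using primes[OF p(1)] pc ring_primeE(2) by (auto simp: ring_prime_def prime_def)
  obtain d where d: "d \<in> carrier R" "a = p \<otimes> d"
    using p(2) by (rule dividesE)
  then have "d \<in> Units R"
    using ring_irreducibleE(5)[OF a pc] p_prime(2) by blast
  then have "a \<sim> p"
    using d(2) pc by (intro associatedI2) auto
  then have "p \<sim>\<^bsub>mult_of R\<^esub> a"
    using associated_sym a(1) pc assoc_iff_assoc_mult by blast
  then have "prime (mult_of R) a"
    using mult_of.prime_cong p_prime(1) pc a ring_irreducibleE(1) prime_nonzero[OF p(1)] by auto
  then show ?thesis
    using ring_primeI' a ring_irreducibleE(1) by blast
qed

lemma irreducible_coprime_imp_prime:
  assumes "factorial_domain L" and a: "a \<in> carrier R" "ring_irreducible a"
    and coprime: "\<And>p. p \<in> P \<Longrightarrow> \<not> p divides a"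
  shows "ring_prime a"
proof -
  interpret L: factorial_domain L by (rule assms(1))
  let ?a = "fraction R S a \<one>"
  have closed: "?a \<in> carrier L"
    using a by (simp add: fraction_closed)
  have irr: "ring_irreducible\<^bsub>L\<^esub> ?a"
    using fraction_irreducible[OF L.domain_axioms a coprime] .
  have "prime (mult_of L) ?a"
    using L.irreducible_prime L.ring_irreducibleE(1,3)[OF closed irr] closed by simp
  then have prime: "prime L ?a"
    using L.prime_eq_prime_mult closed by blast
  have "prime R a"
  proof (rule primeI)
    show "a \<notin> Units R" by (rule ring_irreducibleE(4)[OF a])
    fix x y assume x: "x \<in> carrier R" and y: "y \<in> carrier R" and dvd: "a divides x \<otimes> y"
    from dvd obtain c where c: "c \<in> carrier R" "x \<otimes> y = a \<otimes> c" by (rule dividesE)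
    then have "fraction R S x \<one> \<otimes>\<^bsub>L\<^esub> fraction R S y \<one> = ?a \<otimes>\<^bsub>L\<^esub> fraction R S c \<one>"
      using a x y by (simp add: localization_mult)
    then have "?a divides\<^bsub>L\<^esub> fraction R S x \<one> \<otimes>\<^bsub>L\<^esub> fraction R S y \<one>"
      by (rule dividesI') (use c(1) in \<open>simp add: fraction_closed\<close>)
    then have "?a divides\<^bsub>L\<^esub> fraction R S x \<one> \<or> ?a divides\<^bsub>L\<^esub> fraction R S y \<one>"
      using prime x y by (auto simp: prime_def fraction_closed)
    then show "a divides x \<or> a divides y"
      using fraction_divides_imp_divides a(1) coprime x y by blast
  qed
  then show ?thesis
    using ring_primeI ring_irreducibleE(1)[OF a] by blast
qed

end


section \<open>Nagata's criterion\<close>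

text \<open>Noetherianity supplies the factorizations into irreducibles; primality of the irreducibles
  makes them unique.\<close>

lemma (in noetherian_domain) factorial_domainI_irreducible_prime:
  assumes "\<And>a. a \<in> carrier R \<Longrightarrow> ring_irreducible a \<Longrightarrow> ring_prime a"
  shows "factorial_domain R"
proof -
  interpret M: primeness_condition_monoid "mult_of R"
  proof (intro primeness_condition_monoid.intro primeness_condition_monoid_axioms.intro)
    show "comm_monoid_cancel (mult_of R)"
      by (rule mult_of.is_comm_monoid_cancel)
    fix a assume "a \<in> carrier (mult_of R)" "irreducible (mult_of R) a"
    then show "prime (mult_of R) a"
      using assms ring_irreducibleI' ring_primeE(2) by auto
  qed
  have "factorial_monoid (mult_of R)"
    using factorization_property M.wfactors_unique by (intro mult_of.factorial_monoidI) auto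
  then show ?thesis
    by (intro factorial_domain.intro domain_axioms)
qed

theorem mainTheorem3:
  fixes R :: "('a, 'b) ring_scheme" (structure)
    and P S :: "'a set"
  assumes "noetherian_domain R"
    and "P \<subseteq> carrier R"
    and "\<And>p. p \<in> P \<Longrightarrow> ring_prime p"
    and "S = submonoid_generate R P"
    and "factorial_domain (localization R S)"
  shows "factorial_domain R"
proof -
  interpret noetherian_domain R by (rule assms(1))
  interpret domain_with_primes R P
    using assms(2,3) by unfold_locales
  have "ring_prime a" if "a \<in> carrier R" "ring_irreducible a" for a
    using irreducible_divisible_imp_prime irreducible_coprime_imp_prime assms(4,5) that by blast
  then show ?thesis
    by (rule factorial_domainI_irreducible_prime)
qed

end
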